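(* If $(G,S)$ is a cube group of rank $\geq 2$, then the geometric representation $\rho:G\to GL(\mathbb{R}^S)$ of $(G,S)$ is reducible (that is, $\mathbb{R}^S$ has a proper nonzero linear subspace invariant under $\rho_g$ for all $g\in G$).
   Context: Let $G$ be a group and $S\subseteq G$ a subset consisting of involutions (elements of order $2$). The Cayley graph $\mathrm{Cay}(G,S)$ is the undirected graph with vertex set $G$ in which $g,g'$ are joined by an edge (labeled $s$) if and only if $g'=gs$ for some $s\in S$. The pair $(G,S)$ is a cube group of rank $n$ if $\mathrm{Cay}(G,S)$ is isomorphic, as a graph, to the $1$-skeleton of the $n$-cube (the hypercube graph on $\{0,1\}^n$). In particular $|S|=n$, $S$ generates $G$, and $|G|=2^n$. Geometric representation. Let $\mathbb{R}^S$ be real Euclidean space with standard orthonormal basis $\{e_s : s\in S\}$. For $T\subseteq S$ there is a unique minimal subcube of $\mathrm{Cay}(G,S)$ containing the identity vertex $1$ and the vertices $s$ for all $s\in T$; let $g_T\in G$ be the vertex opposite $1$ in this subcube (so $g_\emptyset=1$ and $g_{\{s\}}=s$). Every element of $G$ is $g_T$ for a unique $T\subseteq S$, and the map $$g_T\mapsto v_T:=\sum_{s\notin T}e_s-\sum_{s\in T}e_s$$ identifies $\mathrm{Cay}(G,S)$ with the $1$-skeleton of the cube $[-1,1]^S\subseteq\mathbb{R}^S$. For $g\in G$, left multiplication by $g$ is an automorphism of $\mathrm{Cay}(G,S)$, hence, under this identification, an automorphism of the $1$-skeleton of $[-1,1]^S$; it is the restriction of a unique orthogonal linear transformation $\rho_g:\mathbb{R}^S\to\mathbb{R}^S$.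 The homomorphism $\rho:G\to GL(\mathbb{R}^S)$, $g\mapsto\rho_g$, is the geometric representation of $(G,S)$. *)

theory Defs
  imports "HOL-Analysis.Analysis" "HOL-Algebra.Multiplicative_Group"
begin

text \<open>A graph is a set of vertices together with a set of undirected edges, each edge being the
  set of its endpoints.\<close>

type_synonym 'v ugraph = "'v set \<times> 'v set set"

definition graph_iso :: "('v \<Rightarrow> 'w) \<Rightarrow> 'v ugraph \<Rightarrow> 'w ugraph \<Rightarrow> bool" where
  "graph_iso f X Y \<longleftrightarrow> bij_betw f (fst X) (fst Y) \<and>
     (\<forall>u\<in>fst X. \<forall>v\<in>fst X. {u, v} \<in> snd X \<longleftrightarrow> {f u, f v} \<in> snd Y)"

definition isomorphic_graphs :: "'v ugraph \<Rightarrow> 'w ugraph \<Rightarrow> bool" where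
  "isomorphic_graphs X Y \<longleftrightarrow> (\<exists>f. graph_iso f X Y)"

definition induced_subgraph :: "'v ugraph \<Rightarrow> 'v set \<Rightarrow> 'v ugraph" where
  "induced_subgraph X C = (C, {e \<in> snd X. e \<subseteq> C})"

definition cube_vertices :: "nat \<Rightarrow> (nat \<Rightarrow> nat) set" where
  "cube_vertices n = {..<n} \<rightarrow>\<^sub>E {0, 1}"

definition cube_graph :: "nat \<Rightarrow> (nat \<Rightarrow> nat) ugraph" where
  "cube_graph n = (cube_vertices n,
     {{x, y} | x y. x \<in> cube_vertices n \<and> y \<in> cube_vertices n \<and>
                    card {i \<in> {..<n}. x i \<noteq> y i} = 1})"

definition subcube :: "'v ugraph \<Rightarrow> 'v set \<Rightarrow> bool" where
  "subcube X C \<longleftrightarrow> C \<subseteq> fst X \<and> (\<exists>k. isomorphic_graphs (induced_subgraph X C) (cube_graph k))"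

definition minimal_subcube :: "'v ugraph \<Rightarrow> 'v set \<Rightarrow> 'v set \<Rightarrow> bool" where
  "minimal_subcube X A C \<longleftrightarrow> subcube X C \<and> A \<subseteq> C \<and>
     (\<forall>D. subcube X D \<and> A \<subseteq> D \<and> D \<subseteq> C \<longrightarrow> D = C)"

definition opposite_in :: "'v ugraph \<Rightarrow> 'v set \<Rightarrow> 'v \<Rightarrow> 'v \<Rightarrow> bool" where
  "opposite_in X C u w \<longleftrightarrow> u \<in> C \<and> w \<in> C \<and>
     (\<exists>k f. graph_iso f (induced_subgraph X C) (cube_graph k) \<and> (\<forall>i<k. f u i \<noteq> f w i))"

definition cayley_graph :: "('a, 'b) monoid_scheme \<Rightarrow> 'a set \<Rightarrow> 'a ugraph" where
  "cayley_graph G S = (carrier G, {{g, g \<otimes>\<^bsub>G\<^esub> s} | g s. g \<in> carrier G \<and> s \<in> S})"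

definition cube_group :: "('a, 'b) monoid_scheme \<Rightarrow> 'a set \<Rightarrow> nat \<Rightarrow> bool" where
  "cube_group G S n \<longleftrightarrow> group G \<and> S \<subseteq> carrier G \<and> (\<forall>s\<in>S. group.ord G s = 2) \<and>
     isomorphic_graphs (cayley_graph G S) (cube_graph n)"

text \<open>The element \<open>g\<^sub>T\<close>.\<close>

definition opposite_vertex :: "('a, 'b) monoid_scheme \<Rightarrow> 'a set \<Rightarrow> 'a set \<Rightarrow> 'a" where
  "opposite_vertex G S T =
     (let C = (THE C. minimal_subcube (cayley_graph G S) (insert \<one>\<^bsub>G\<^esub> T) C)
      in THE g. opposite_in (cayley_graph G S) C \<one>\<^bsub>G\<^esub> g)"

text \<open>The space \<open>\<real>\<^sup>S\<close> is rendered as \<open>real ^ 's\<close>, where a bijection \<open>\<sigma>\<close> from the finite type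
  \<open>'s\<close> onto \<open>S\<close> labels the coordinates; the basis vector of \<open>\<sigma> i\<close> is \<open>axis i 1\<close>.\<close>

definition sign_vector :: "('s::finite \<Rightarrow> 'a) \<Rightarrow> 'a set \<Rightarrow> real ^ 's" where
  "sign_vector \<sigma> T = (\<Sum>i | \<sigma> i \<notin> T. axis i 1) - (\<Sum>i | \<sigma> i \<in> T. axis i 1)"

definition vertex_vector ::
    "('a, 'b) monoid_scheme \<Rightarrow> 'a set \<Rightarrow> ('s::finite \<Rightarrow> 'a) \<Rightarrow> 'a \<Rightarrow> real ^ 's" where
  "vertex_vector G S \<sigma> g = sign_vector \<sigma> (THE T. T \<subseteq> S \<and> opposite_vertex G S T = g)"

definition geometric_rep ::
    "('a, 'b) monoid_scheme \<Rightarrow> 'a set \<Rightarrow> ('s::finite \<Rightarrow> 'a) \<Rightarrow> 'a \<Rightarrow> real ^ 's \<Rightarrow> real ^ 's" where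
  "geometric_rep G S \<sigma> g =
     (THE f. orthogonal_transformation f \<and>
        (\<forall>h\<in>carrier G. f (vertex_vector G S \<sigma> h) = vertex_vector G S \<sigma> (g \<otimes>\<^bsub>G\<^esub> h)))"

definition reducible_rep ::
    "('a, 'b) monoid_scheme \<Rightarrow> ('a \<Rightarrow> 'v \<Rightarrow> 'v::real_vector) \<Rightarrow> bool" where
  "reducible_rep G \<rho> \<longleftrightarrow>
     (\<exists>W. subspace W \<and> W \<noteq> {0} \<and> W \<noteq> UNIV \<and> (\<forall>g\<in>carrier G. \<rho> g ` W \<subseteq> W))"

end

theory Submission
  imports Defs "HOL-Algebra.Group_Action"
begin

text \<open>Identify the vertices of the Cayley graph with subsets of \<open>S\<close>. Left multiplication by \<open>g\<close> becomes
  a signed permutation, and since each generator \<open>s\<close> is an involution swapping the vertices \<open>{}\<close> and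
  \<open>{s}\<close>, its permutation part fixes \<open>s\<close>. The 2-group \<open>G\<close> permutes the \<open>2\<^sup>n - 2\<close> proper
  nonempty subsets of \<open>S\<close>; as \<open>2\<^sup>n - 2\<close> is not divisible by 4, there is an orbit with at most two
  elements. If its intersection is nonempty or its union is not \<open>S\<close>, this is an invariant proper
  nonempty subset. Otherwise the orbit consists of a set and its complement, which no generator
  \<open>s\<close> can exchange because it fixes the point \<open>s\<close>. The coordinate subspace of an invariant proper
  nonempty subset is an invariant subspace.\<close>

section \<open>Cube vertices as subsets of a set of coordinates\<close>

definition set_adj :: "'a set \<Rightarrow> 'a set \<Rightarrow> bool" where
  "set_adj A B \<longleftrightarrow> (\<exists>i. sym_diff A B = {i})"

text \<open>An isomorphism onto the cube in which a vertex is the set of its nonzero coordinates.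
  The coordinate set is arbitrary, so that coordinates can later be the generators
  themselves.\<close>

definition cube_labelling :: "('v \<Rightarrow> 'i set) \<Rightarrow> 'v ugraph \<Rightarrow> 'i set \<Rightarrow> bool" where
  "cube_labelling F X I \<longleftrightarrow> bij_betw F (fst X) (Pow I) \<and>
     (\<forall>u\<in>fst X. \<forall>v\<in>fst X. {u, v} \<in> snd X \<longleftrightarrow> set_adj (F u) (F v))"

definition ones :: "nat \<Rightarrow> (nat \<Rightarrow> nat) \<Rightarrow> nat set" where
  "ones n x = {i. i < n \<and> x i = 1}"

lemma set_adj_iff_card: "set_adj A B \<longleftrightarrow> card (sym_diff A B) = 1"
  by (simp add: set_adj_def card_1_singleton_iff)

lemma sym_diff_image:
  assumes "inj_on f I" "A \<subseteq> I" "B \<subseteq> I"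
  shows "sym_diff (f ` A) (f ` B) = f ` sym_diff A B"
  using assms unfolding inj_on_def by blast

lemma set_adj_image:
  assumes "inj_on f I" "A \<subseteq> I" "B \<subseteq> I"
  shows "set_adj (f ` A) (f ` B) \<longleftrightarrow> set_adj A B"
proof -
  have sub: "sym_diff A B \<subseteq> I" using assms by blast
  have "set_adj (f ` A) (f ` B) \<longleftrightarrow> card (f ` sym_diff A B) = 1"
    unfolding set_adj_iff_card sym_diff_image[OF assms] ..
  also have "\<dots> \<longleftrightarrow> card (sym_diff A B) = 1"
    using card_image[OF inj_on_subset[OF assms(1) sub]] by simp
  finally show ?thesis unfolding set_adj_iff_card .
qed

lemma sym_diff_cancel: "sym_diff U (sym_diff U A) = A"
  by blast

lemma set_adj_translate: "set_adj (sym_diff U A) (sym_diff U B) \<longleftrightarrow> set_adj A B"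
proof -
  have "sym_diff (sym_diff U A) (sym_diff U B) = sym_diff A B" by blast
  then show ?thesis unfolding set_adj_def by simp
qed

lemma bij_betw_ones: "bij_betw (ones n) (cube_vertices n) (Pow {..<n})"
\<comment> \<open>The inverse is the indicator function, cut off outside \<open>{..<n}\<close>
  because \<open>cube_vertices\<close> consists of extensional functions.\<close>
proof (rule bij_betw_byWitness[where f' = "\<lambda>A. \<lambda>i\<in>{..<n}. if i \<in> A then 1 else 0"])
  show "\<forall>x\<in>cube_vertices n. (\<lambda>i\<in>{..<n}. if i \<in> ones n x then 1 else 0) = x"
  proof
    fix x assume x: "x \<in> cube_vertices n"
    show "(\<lambda>i\<in>{..<n}. if i \<in> ones n x then 1 else 0) = x"
    proof
      fix i
      show "(\<lambda>i\<in>{..<n}. if i \<in> ones n x then 1 else 0) i = x i"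
        using x unfolding cube_vertices_def ones_def
        by (cases "i < n") (auto simp: PiE_iff extensional_def)
    qed
  qed
qed (auto simp: ones_def cube_vertices_def split: if_splits)

lemma differ_ones:
  assumes "x \<in> cube_vertices n" "y \<in> cube_vertices n"
  shows "{i \<in> {..<n}. x i \<noteq> y i} = sym_diff (ones n x) (ones n y)"
proof -
  have "x i \<noteq> y i \<longleftrightarrow> (x i = 1) \<noteq> (y i = 1)" if "i < n" for i
  proof -
    have "x i \<in> {0, 1}" "y i \<in> {0, 1}"
      using assms that unfolding cube_vertices_def by (auto simp: PiE_iff)
    then show ?thesis by auto
  qed
  then show ?thesis unfolding ones_def by auto
qed

lemma cube_graph_edge:
  assumes "x \<in> cube_vertices n" "y \<in> cube_vertices n"
  shows "{x, y} \<in> snd (cube_graph n) \<longleftrightarrow> set_adj (ones n x) (ones n y)"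
proof -
  have "{x, y} \<in> snd (cube_graph n) \<longleftrightarrow> card {i \<in> {..<n}. x i \<noteq> y i} = 1"
  proof
    assume "{x, y} \<in> snd (cube_graph n)"
    then obtain a b where "{x, y} = {a, b}" and c: "card {i \<in> {..<n}. a i \<noteq> b i} = 1"
      unfolding cube_graph_def by auto
    then consider "x = a" "y = b" | "x = b" "y = a" by (auto simp: doubleton_eq_iff)
    then show "card {i \<in> {..<n}. x i \<noteq> y i} = 1"
    proof cases
      case 2
      moreover have "{i \<in> {..<n}. b i \<noteq> a i} = {i \<in> {..<n}. a i \<noteq> b i}" by auto
      ultimately show ?thesis using c by simp
    qed (use c in simp)
  qed (use assms in \<open>auto simp: cube_graph_def\<close>)
  then show ?thesis
    unfolding differ_ones[OF assms] set_adj_iff_card .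
qed

lemma graph_iso_cube_graph_labelling:
  assumes "graph_iso h X (cube_graph k)"
  shows "cube_labelling (ones k \<circ> h) X {..<k}"
proof -
  have h: "bij_betw h (fst X) (cube_vertices k)"
    using assms unfolding graph_iso_def cube_graph_def by simp
  moreover have "{u, v} \<in> snd X \<longleftrightarrow> set_adj ((ones k \<circ> h) u) ((ones k \<circ> h) v)"
    if "u \<in> fst X" "v \<in> fst X" for u v
  proof -
    have "h u \<in> cube_vertices k" "h v \<in> cube_vertices k"
      using h that by (auto dest: bij_betwE)
    then show ?thesis using assms that cube_graph_edge unfolding graph_iso_def by auto
  qed
  ultimately show ?thesis
    unfolding cube_labelling_def using bij_betw_trans[OF h bij_betw_ones] by blast
qed

lemma cube_labelling_image:
  assumes F: "cube_labelling F X I" and b: "bij_betw b I J"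
  shows "cube_labelling (\<lambda>u. b ` F u) X J"
proof -
  have FX: "bij_betw F (fst X) (Pow I)" using F unfolding cube_labelling_def by simp
  have inj: "inj_on b I" using b by (simp add: bij_betw_def)
  have "bij_betw ((`) b \<circ> F) (fst X) (Pow J)"
    by (rule bij_betw_trans[OF FX bij_betw_Pow[OF b]])
  then have "bij_betw (\<lambda>u. b ` F u) (fst X) (Pow J)" by (simp add: comp_def)
  moreover have "set_adj (b ` F u) (b ` F v) \<longleftrightarrow> set_adj (F u) (F v)"
    if "u \<in> fst X" "v \<in> fst X" for u v
    using set_adj_image[OF inj] FX that by (auto dest!: bij_betwE)
  ultimately show ?thesis using F unfolding cube_labelling_def by simp
qed

text \<open>Translation by \<open>U\<close> is an involution of \<open>Pow I\<close> that preserves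
  symmetric differences. Taking for \<open>U\<close> the label of a chosen vertex moves that vertex
  to the label \<open>{}\<close>.\<close>

lemma cube_labelling_translate:
  assumes F: "cube_labelling F X I" and U: "U \<subseteq> I"
  shows "cube_labelling (\<lambda>u. sym_diff U (F u)) X I"
proof -
  have "bij_betw (sym_diff U) (Pow I) (Pow I)"
    by (rule bij_betw_byWitness[where f' = "sym_diff U"]) (use U in auto)
  then have "bij_betw (sym_diff U \<circ> F) (fst X) (Pow I)"
    using F bij_betw_trans unfolding cube_labelling_def by blast
  then show ?thesis
    using F unfolding cube_labelling_def set_adj_translate by (simp add: comp_def)
qed

text \<open>Converse to \<open>graph_iso_cube_graph_labelling\<close>: number the coordinates by
  \<open>{..<card I}\<close>, then turn subsets back into 0/1 functions.\<close>

lemma cube_labelling_graph_iso: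
  assumes "cube_labelling F X I" and "finite I"
  shows "\<exists>h. graph_iso h X (cube_graph (card I))"
proof -
  define k where "k = card I"
  obtain b where b: "bij_betw b I {..<k}"
    using ex_bij_betw_finite_nat[OF \<open>finite I\<close>] unfolding k_def lessThan_atLeast0 by blast
  define L where "L = (\<lambda>u. b ` F u)"
  have lab: "cube_labelling L X {..<k}"
    unfolding L_def by (rule cube_labelling_image[OF assms(1) b])
  then have LX: "bij_betw L (fst X) (Pow {..<k})" unfolding cube_labelling_def by simp
  define r where "r = inv_into (cube_vertices k) (ones k)"
  have r: "bij_betw r (Pow {..<k}) (cube_vertices k)"
    unfolding r_def by (rule bij_betw_inv_into[OF bij_betw_ones])
  have ones_r: "ones k (r A) = A" if "A \<subseteq> {..<k}" for A
    unfolding r_def using bij_betw_inv_into_right[OF bij_betw_ones] that by blast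
  have "bij_betw (r \<circ> L) (fst X) (fst (cube_graph k))"
    using bij_betw_trans[OF LX r] by (simp add: cube_graph_def)
  moreover have "{u, v} \<in> snd X \<longleftrightarrow> {(r \<circ> L) u, (r \<circ> L) v} \<in> snd (cube_graph k)"
    if uv: "u \<in> fst X" "v \<in> fst X" for u v
  proof -
    have sub: "L u \<subseteq> {..<k}" "L v \<subseteq> {..<k}" using LX uv by (auto dest!: bij_betwE)
    then have "r (L u) \<in> cube_vertices k" "r (L v) \<in> cube_vertices k"
      using r by (auto dest: bij_betwE)
    then show ?thesis
      using cube_graph_edge ones_r[OF sub(1)] ones_r[OF sub(2)] lab uv
      unfolding cube_labelling_def by simp
  qed
  ultimately show ?thesis unfolding graph_iso_def k_def by blast
qed

section \<open>Rigidity of cube embeddings\<close>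

text \<open>The sets \<open>insert a Q\<close> and \<open>insert b Q\<close> differ exactly in
  \<open>a\<close> and \<open>b\<close>, so the single change \<open>c\<close> leading from the
  first one to \<open>X\<close> is \<open>a\<close> or \<open>b\<close>. Removing \<open>a\<close>
  gives the excluded corner \<open>Q\<close>; adding \<open>b\<close> gives the opposite
  corner.\<close>

lemma singleton_sym_diff_square:
  assumes "sym_diff X (insert a Q) = {c}" "sym_diff X (insert b Q) = {d}"
    and "a \<notin> Q" "b \<notin> Q" "a \<noteq> b" "X \<noteq> Q"
  shows "X = insert a (insert b Q)"
proof -
  have 1: "z \<in> X \<longleftrightarrow> (z \<in> insert a Q) \<noteq> (z = c)" for z
    using assms(1) by blast
  have 2: "z \<in> X \<longleftrightarrow> (z \<in> insert b Q) \<noteq> (z = d)" for z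
    using assms(2) by blast
  have "c = a \<or> c = b"
    using 1[of a] 2[of a] 1[of b] 2[of b] assms(3-5) by auto
  then show ?thesis
  proof
    assume "c = a"
    then have "X = Q" using 1 assms(3) by blast
    then show ?thesis using assms(6) by simp
  next
    assume "c = b"
    then show ?thesis using 1 assms(4,5) by blast
  qed
qed

text \<open>In a cube, the fourth vertex of a 4-cycle is determined by the other three, so an adjacency
  preserving injection of cubes is determined by the neighbours of one vertex.\<close>

lemma cube_embedding:
  fixes \<phi> :: "'k set \<Rightarrow> 'i set"
  assumes "finite K" and inj: "inj_on \<phi> (Pow K)"
    and adj: "\<And>A B. A \<subseteq> K \<Longrightarrow> B \<subseteq> K \<Longrightarrow> set_adj A B \<Longrightarrow> set_adj (\<phi> A) (\<phi> B)"
  obtains q where "inj_on q K" "\<forall>A\<subseteq>K. \<phi> A = sym_diff (\<phi> {}) (q ` A)"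
proof -
  \<comment> \<open>Translating by \<open>\<phi> {}\<close> makes the map fix the empty set and
    keeps it injective and adjacency preserving.\<close>
  define \<psi> where "\<psi> = (\<lambda>A. sym_diff (\<phi> {}) (\<phi> A))"
  have \<psi>0: "\<psi> {} = {}" by (simp add: \<psi>_def)
  have \<phi>\<psi>: "\<phi> A = sym_diff (\<phi> {}) (\<psi> A)" for A
    unfolding \<psi>_def by (rule sym_diff_cancel[symmetric])
  have \<psi>_inj: "A = B" if "A \<subseteq> K" "B \<subseteq> K" "\<psi> A = \<psi> B" for A B
    using inj that \<phi>\<psi>[of A] \<phi>\<psi>[of B] by (auto simp: inj_on_def)
  have \<psi>_adj: "set_adj (\<psi> A) (\<psi> B)" if "A \<subseteq> K" "B \<subseteq> K" "set_adj A B" for A B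
    unfolding \<psi>_def set_adj_translate by (rule adj[OF that])
  \<comment> \<open>Singletons are neighbours of the empty set, which is fixed, so they go to
    singletons; this defines \<open>q\<close>.\<close>
  have "\<exists>j. \<psi> {i} = {j}" if "i \<in> K" for i
  proof -
    have "set_adj (\<psi> {}) (\<psi> {i})" using that by (intro \<psi>_adj) (auto simp: set_adj_def)
    then show ?thesis by (simp add: \<psi>0 set_adj_def)
  qed
  then obtain q where q: "\<And>i. i \<in> K \<Longrightarrow> \<psi> {i} = {q i}" by metis
  have q_inj: "inj_on q K"
  proof (rule inj_onI)
    fix i j assume "i \<in> K" "j \<in> K" "q i = q j"
    then show "i = j" using \<psi>_inj[of "{i}" "{j}"] q by auto
  qed
  have q_neq: "q i \<noteq> q j" if "i \<in> K" "j \<in> K" "i \<noteq> j" for i j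
    using q_inj that by (auto simp: inj_on_def)
  have image: "\<psi> A = q ` A" if "A \<subseteq> K" for A
    using that
  proof (induction "card A" arbitrary: A rule: less_induct)
    case less
    have fin: "finite A" using less.prems \<open>finite K\<close> finite_subset by blast
    show ?case
    proof (cases "A = {} \<or> (\<exists>i. A = {i})")
      case True
      then show ?thesis using \<psi>0 q less.prems by auto
    next
      case False
      then obtain i j where ij: "i \<in> A" "j \<in> A" "i \<noteq> j" by blast
      \<comment> \<open>\<open>A\<close> is the fourth corner of the square with corners
        \<open>B\<close>, \<open>insert i B\<close> and \<open>insert j B\<close>, all smaller and
        hence covered by the induction hypothesis.\<close>
      define B where "B = A - {i, j}"
      have A: "A = insert i (insert j B)" "i \<notin> B" "j \<notin> B"
        using ij by (auto simp: B_def)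
      have sub: "B \<subseteq> K" "insert i B \<subseteq> K" "insert j B \<subseteq> K" "i \<in> K" "j \<in> K"
        using A less.prems by auto
      have "finite B" using fin by (simp add: B_def)
      then have "card B < card A" "card (insert i B) < card A" "card (insert j B) < card A"
        using A ij by auto
      then have IH: "\<psi> B = q ` B" "\<psi> (insert i B) = insert (q i) (q ` B)"
          "\<psi> (insert j B) = insert (q j) (q ` B)"
        using less.hyps sub by auto
      have "sym_diff A (insert i B) = {j}" "sym_diff A (insert j B) = {i}"
        using A ij by auto
      then have "set_adj (\<psi> A) (insert (q i) (q ` B))" "set_adj (\<psi> A) (insert (q j) (q ` B))"
        using \<psi>_adj[OF less.prems sub(2)] \<psi>_adj[OF less.prems sub(3)] IH
        by (auto simp: set_adj_def)
      moreover have "q i \<notin> q ` B" "q j \<notin> q ` B"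
        using A sub q_neq by (metis image_iff subsetD)+
      moreover have "q i \<noteq> q j" using q_neq ij sub by simp
      \<comment> \<open>Injectivity rules out the other common neighbour, the image of
        \<open>B\<close>.\<close>
      moreover have "\<psi> A \<noteq> q ` B" using \<psi>_inj[OF less.prems sub(1)] IH(1) A by auto
      ultimately have "\<psi> A = insert (q i) (insert (q j) (q ` B))"
        unfolding set_adj_def using singleton_sym_diff_square by metis
      then show ?thesis using A by auto
    qed
  qed
  have "\<phi> A = sym_diff (\<phi> {}) (q ` A)" if "A \<subseteq> K" for A
    using \<phi>\<psi>[of A] image[OF that] by simp
  then show thesis using that[OF q_inj] by blast
qed

section \<open>Subcubes as faces\<close>

text \<open>Read backwards, \<open>h\<close> embeds a cube into the big cube, so
  \<open>cube_embedding\<close> makes it a translate of an injection \<open>q\<close> of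
  coordinates; \<open>K\<close> is the set of directions hit by \<open>q\<close>. Symmetric
  differences describe the face from any of its vertices, and show that opposite vertices are those
  differing in all of \<open>K\<close>.\<close>

lemma subcube_is_face:
  fixes F :: "'v \<Rightarrow> 'i set"
  assumes F: "cube_labelling F X I" and C: "C \<subseteq> fst X"
    and h: "graph_iso h (induced_subgraph X C) (cube_graph k)"
  obtains K where "K \<subseteq> I"
    "\<forall>u\<in>C. \<forall>w\<in>fst X. w \<in> C \<longleftrightarrow> sym_diff (F u) (F w) \<subseteq> K"
    "\<forall>u\<in>C. \<forall>w\<in>C. (\<forall>i<k. h u i \<noteq> h w i) \<longleftrightarrow> sym_diff (F u) (F w) = K"
proof -
  define \<psi> where "\<psi> = ones k \<circ> h"
  have lab: "cube_labelling \<psi> (induced_subgraph X C) {..<k}"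
    unfolding \<psi>_def by (rule graph_iso_cube_graph_labelling[OF h])
  then have \<psi>: "bij_betw \<psi> C (Pow {..<k})"
    unfolding cube_labelling_def induced_subgraph_def by simp
  have FX: "bij_betw F (fst X) (Pow I)" using F unfolding cube_labelling_def by simp
  have F_inj: "inj_on F (fst X)" using FX by (simp add: bij_betw_def)
  define r where "r = inv_into C \<psi>"
  have r: "bij_betw r (Pow {..<k}) C" unfolding r_def by (rule bij_betw_inv_into[OF \<psi>])
  have rC: "r A \<in> C" if "A \<subseteq> {..<k}" for A using r that by (auto dest: bij_betwE)
  have \<psi>r: "\<psi> (r A) = A" if "A \<subseteq> {..<k}" for A
    unfolding r_def using bij_betw_inv_into_right[OF \<psi>] that by blast
  have r\<psi>: "r (\<psi> u) = u" if "u \<in> C" for u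
    unfolding r_def using bij_betw_inv_into_left[OF \<psi>] that by blast
  have \<psi>_sub: "\<psi> u \<subseteq> {..<k}" if "u \<in> C" for u
    using \<psi> that by (auto dest: bij_betwE)
  have inj: "inj_on (F \<circ> r) (Pow {..<k})"
    using comp_inj_on[of r "Pow {..<k}" F] r inj_on_subset[OF F_inj C]
    by (simp add: bij_betw_def)
  have adj: "set_adj ((F \<circ> r) A) ((F \<circ> r) B)"
    if AB: "A \<subseteq> {..<k}" "B \<subseteq> {..<k}" "set_adj A B" for A B
  proof -
    have "{r A, r B} \<in> snd (induced_subgraph X C)"
      using lab AB rC \<psi>r unfolding cube_labelling_def by (auto simp: induced_subgraph_def)
    then have "{r A, r B} \<in> snd X" by (simp add: induced_subgraph_def)
    moreover have "r A \<in> fst X" "r B \<in> fst X" using rC AB C by auto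
    ultimately show ?thesis using F unfolding cube_labelling_def by simp
  qed
  obtain q where q: "inj_on q {..<k}"
    and q_image: "\<forall>A\<subseteq>{..<k}. (F \<circ> r) A = sym_diff ((F \<circ> r) {}) (q ` A)"
    by (rule cube_embedding[OF finite_lessThan inj]) (erule (2) adj, rule that)
  define U where "U = F (r {})"
  have Fr: "F (r A) = sym_diff U (q ` A)" if "A \<subseteq> {..<k}" for A
    using q_image[rule_format, OF that] by (simp add: U_def)
  have FU: "F u = sym_diff U (q ` \<psi> u)" if "u \<in> C" for u
    using Fr[OF \<psi>_sub[OF that]] r\<psi>[OF that] by simp
  have diff: "sym_diff (F u) (F w) = q ` sym_diff (\<psi> u) (\<psi> w)" if "u \<in> C" "w \<in> C" for u w
  proof -
    have "sym_diff (F u) (F w) = sym_diff (q ` \<psi> u) (q ` \<psi> w)"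
      unfolding FU[OF that(1)] FU[OF that(2)] by blast
    then show ?thesis using sym_diff_image[OF q \<psi>_sub \<psi>_sub] that by simp
  qed
  have F_sub: "F u \<subseteq> I" if "u \<in> fst X" for u using FX that by (auto dest: bij_betwE)
  define K where "K = q ` {..<k}"
  show thesis
  proof (rule that[of K]; (intro ballI)?)
    \<comment> \<open>\<open>K\<close> is the difference of two opposite corners of the face, both
      labelled by subsets of \<open>I\<close>.\<close>
    have "K = sym_diff (F (r {})) (F (r {..<k}))"
      using Fr[of "{..<k}"] unfolding U_def[symmetric] K_def by blast
    moreover have "F (r {}) \<subseteq> I" "F (r {..<k}) \<subseteq> I" using F_sub rC C by auto
    ultimately show "K \<subseteq> I" by blast
  next
    fix u w assume u: "u \<in> C" and w: "w \<in> fst X"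
    show "w \<in> C \<longleftrightarrow> sym_diff (F u) (F w) \<subseteq> K"
    proof
      assume "w \<in> C"
      then show "sym_diff (F u) (F w) \<subseteq> K"
        unfolding diff[OF u \<open>w \<in> C\<close>] K_def using \<psi>_sub u by (intro image_mono) blast
    next
      assume "sym_diff (F u) (F w) \<subseteq> K"
      then obtain A where A: "A \<subseteq> {..<k}" "sym_diff (F u) (F w) = q ` A"
        unfolding K_def by (auto simp: subset_image_iff)
      \<comment> \<open>Moving from \<open>u\<close> along the directions in \<open>A\<close> inside
        the small cube leads to \<open>r B\<close>, which has the same label as
        \<open>w\<close>.\<close>
      define B where "B = sym_diff (\<psi> u) A"
      have B: "B \<subseteq> {..<k}" unfolding B_def using A(1) \<psi>_sub[OF u] by blast
      have "F w = sym_diff (F u) (q ` A)"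
        unfolding A(2)[symmetric] by (rule sym_diff_cancel[symmetric])
      also have "\<dots> = sym_diff U (sym_diff (q ` \<psi> u) (q ` A))"
        unfolding FU[OF u] by blast
      also have "\<dots> = F (r B)"
        using Fr[OF B] sym_diff_image[OF q \<psi>_sub[OF u] A(1)] by (simp add: B_def)
      finally have "w = r B"
        using F_inj w rC[OF B] C by (auto simp: inj_on_def)
      then show "w \<in> C" using rC[OF B] by simp
    qed
  next
    fix u w assume u: "u \<in> C" and w: "w \<in> C"
    have hC: "h u \<in> cube_vertices k" "h w \<in> cube_vertices k"
      using h u w unfolding graph_iso_def induced_subgraph_def cube_graph_def
      by (auto dest: bij_betwE)
    have "(\<forall>i<k. h u i \<noteq> h w i) \<longleftrightarrow> {i \<in> {..<k}. h u i \<noteq> h w i} = {..<k}" by auto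
    also have "\<dots> \<longleftrightarrow> sym_diff (\<psi> u) (\<psi> w) = {..<k}"
      unfolding differ_ones[OF hC] \<psi>_def by simp
    also have "\<dots> \<longleftrightarrow> q ` sym_diff (\<psi> u) (\<psi> w) = q ` {..<k}"
      using inj_on_image_eq_iff[OF q, of "sym_diff (\<psi> u) (\<psi> w)" "{..<k}"] \<psi>_sub u w by blast
    finally show "(\<forall>i<k. h u i \<noteq> h w i) \<longleftrightarrow> sym_diff (F u) (F w) = K"
      unfolding diff[OF u w] K_def .
  qed
qed

text \<open>The labelling \<open>F\<close> itself restricts to a bijection from the vertices with
  label inside \<open>T\<close> onto \<open>Pow T\<close>.\<close>

lemma face_is_subcube:
  assumes F: "cube_labelling F X I" and T: "T \<subseteq> I" "finite T"
  shows "\<exists>h. graph_iso h (induced_subgraph X {w \<in> fst X. F w \<subseteq> T}) (cube_graph (card T))"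
proof (rule cube_labelling_graph_iso[OF _ T(2)])
  have FX: "bij_betw F (fst X) (Pow I)" using F unfolding cube_labelling_def by simp
  have "bij_betw F {w \<in> fst X. F w \<subseteq> T} (Pow T)"
  proof (rule bij_betw_subset[OF FX])
    show "F ` {w \<in> fst X. F w \<subseteq> T} = Pow T"
    proof (intro equalityI subsetI)
      fix A assume A: "A \<in> Pow T"
      then have "A \<in> F ` fst X" using FX T by (auto simp: bij_betw_def)
      then show "A \<in> F ` {w \<in> fst X. F w \<subseteq> T}" using A by blast
    qed auto
  qed auto
  then show "cube_labelling F (induced_subgraph X {w \<in> fst X. F w \<subseteq> T}) T"
    using F unfolding cube_labelling_def induced_subgraph_def by simp
qed

section \<open>Small orbits of p-groups\<close>

text \<open>Orbit sizes divide \<open>p ^ n\<close>, so they are powers of \<open>p\<close>. If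
  every exponent were at least \<open>m\<close>, then \<open>p ^ m\<close> would divide their sum
  \<open>card E\<close>.\<close>

lemma (in group_action) ex_small_orbit:
  assumes "prime p" "order G = p ^ n" "finite E" "\<not> p ^ m dvd card E"
  shows "\<exists>x\<in>E. \<exists>i<m. card (orbit G \<phi> x) = p ^ i"
proof (rule ccontr)
  assume large: "\<not> ?thesis"
  have "p ^ m dvd card Q" if Q: "Q \<in> orbits G E \<phi>" for Q
  proof -
    obtain x where x: "x \<in> E" "Q = orbit G \<phi> x" using Q unfolding orbits_def by blast
    have "card Q dvd p ^ n"
      unfolding x(2) assms(2)[symmetric] orbit_stabilizer_theorem[OF x(1), symmetric] by simp
    then obtain i where i: "card Q = p ^ i"
      using divides_primepow_nat[OF \<open>prime p\<close>] by blast
    moreover have "m \<le> i" using large x i not_less by blast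
    ultimately show ?thesis by (simp add: le_imp_power_dvd)
  qed
  then have "p ^ m dvd (\<Sum>Q\<in>orbits G E \<phi>. card Q)" by (rule dvd_sum)
  also have "\<dots> = card E"
    using partition.disjoint_sum[OF orbit_partition assms(3), of "\<lambda>_. 1::nat"] by simp
  finally show False using assms(4) by simp
qed

section \<open>Labelling a cube group by subsets of its generators\<close>

text \<open>An unordered edge may have been recorded from either endpoint; since each generator is
  its own inverse, it can be read from \<open>g\<close> in both cases.\<close>

lemma cayley_graph_edge:
  assumes "group G" "S \<subseteq> carrier G" "\<And>s. s \<in> S \<Longrightarrow> s \<otimes>\<^bsub>G\<^esub> s = \<one>\<^bsub>G\<^esub>"
    and "g \<in> carrier G" "h \<in> carrier G"
  shows "{g, h} \<in> snd (cayley_graph G S) \<longleftrightarrow> (\<exists>s\<in>S. h = g \<otimes>\<^bsub>G\<^esub> s)"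
proof
  interpret group G by fact
  assume "{g, h} \<in> snd (cayley_graph G S)"
  then obtain a s where as: "a \<in> carrier G" "s \<in> S" "{g, h} = {a, a \<otimes>\<^bsub>G\<^esub> s}"
    unfolding cayley_graph_def by auto
  have "s \<in> carrier G" using as assms(2) by blast
  then have "a \<otimes>\<^bsub>G\<^esub> s \<otimes>\<^bsub>G\<^esub> s = a" using assms(3)[OF as(2)] as(1) by (simp add: m_assoc)
  then show "\<exists>s\<in>S. h = g \<otimes>\<^bsub>G\<^esub> s" using as(2,3) by (metis doubleton_eq_iff)
qed (use assms(4) in \<open>auto simp: cayley_graph_def\<close>)

text \<open>\<open>F\<close> is the inverse of the map sending \<open>T\<close> to the vertex \<open>g\<^sub>T\<close>.\<close>

locale labelled_cube_group = group G for G :: "('a, 'b) monoid_scheme" (structure) +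
  fixes S :: "'a set" and F :: "'a \<Rightarrow> 'a set"
  assumes gens_closed: "S \<subseteq> carrier G"
    and finite_gens: "finite S"
    and involution: "s \<in> S \<Longrightarrow> s \<otimes> s = \<one>"
    and labelling: "cube_labelling F (cayley_graph G S) S"
    and label_one: "F \<one> = {}"
    and label_gen: "s \<in> S \<Longrightarrow> F s = {s}"

text \<open>After a translation the identity has label \<open>{}\<close>. Its neighbours are the
  generators, and the neighbours of \<open>{}\<close> are the singletons, so generators correspond
  to coordinates; renaming coordinates along this bijection gives \<open>s\<close> the label
  \<open>{s}\<close>.\<close>

lemma cube_group_labelling:
  assumes "cube_group G S n"
  obtains F where "labelled_cube_group G S F" "card S = n"
proof -
  have G: "group G" "S \<subseteq> carrier G" and ord: "\<And>s. s \<in> S \<Longrightarrow> group.ord G s = 2"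
    using assms unfolding cube_group_def by auto
  interpret group G by fact
  have inv: "s \<otimes>\<^bsub>G\<^esub> s = \<one>\<^bsub>G\<^esub>" if "s \<in> S" for s
    using pow_ord_eq_1[of s] ord[OF that] that G(2) by (auto simp: numeral_2_eq_2)
  let ?X = "cayley_graph G S"
  note edge = cayley_graph_edge[OF G inv]
  obtain f where "graph_iso f ?X (cube_graph n)"
    using assms unfolding cube_group_def isomorphic_graphs_def by blast
  then obtain \<phi> where \<phi>: "cube_labelling \<phi> ?X {..<n}"
    using graph_iso_cube_graph_labelling by blast
  have "\<phi> \<one>\<^bsub>G\<^esub> \<subseteq> {..<n}"
    using \<phi> unfolding cube_labelling_def cayley_graph_def by (auto dest!: bij_betwE)
  define \<psi> where "\<psi> = (\<lambda>g. sym_diff (\<phi> \<one>\<^bsub>G\<^esub>) (\<phi> g))"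
  have \<psi>: "cube_labelling \<psi> ?X {..<n}"
    unfolding \<psi>_def by (rule cube_labelling_translate) fact+
  have \<psi>1: "\<psi> \<one>\<^bsub>G\<^esub> = {}" by (simp add: \<psi>_def)
  have \<psi>_bij: "bij_betw \<psi> (carrier G) (Pow {..<n})"
    using \<psi> unfolding cube_labelling_def cayley_graph_def by simp
  have near1: "(\<exists>i. \<psi> g = {i}) \<longleftrightarrow> g \<in> S" if "g \<in> carrier G" for g
  proof -
    have "(\<exists>i. \<psi> g = {i}) \<longleftrightarrow> set_adj (\<psi> \<one>\<^bsub>G\<^esub>) (\<psi> g)" unfolding \<psi>1 set_adj_def by simp
    also have "\<dots> \<longleftrightarrow> {\<one>\<^bsub>G\<^esub>, g} \<in> snd ?X"
      using \<psi> that unfolding cube_labelling_def by (simp add: cayley_graph_def)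
    also have "\<dots> \<longleftrightarrow> g \<in> S" using edge[OF _ one_closed that] l_one G(2) by (metis subsetD)
    finally show ?thesis .
  qed
  then obtain \<tau> where \<tau>: "\<And>s. s \<in> S \<Longrightarrow> \<psi> s = {\<tau> s}" using G(2) by (metis subsetD)
  have "inj_on \<tau> S"
  proof (rule inj_onI)
    fix s t assume "s \<in> S" "t \<in> S" "\<tau> s = \<tau> t"
    then have "\<psi> s = \<psi> t" "s \<in> carrier G" "t \<in> carrier G" using \<tau> G(2) by auto
    then show "s = t" using inj_onD[OF bij_betw_imp_inj_on[OF \<psi>_bij]] by simp
  qed
  moreover have "\<tau> ` S = {..<n}"
  proof (intro equalityI subsetI)
    fix i assume "i \<in> \<tau> ` S"
    then obtain s where "s \<in> S" "i = \<tau> s" by blast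
    then show "i \<in> {..<n}" using \<tau>[of s] bij_betwE[OF \<psi>_bij] G(2) by auto
  next
    fix i assume "i \<in> {..<n}"
    then have "{i} \<in> \<psi> ` carrier G" using \<psi>_bij by (auto simp: bij_betw_def)
    then obtain g where "g \<in> carrier G" "\<psi> g = {i}" by auto
    then show "i \<in> \<tau> ` S" using near1 \<tau>[of g] by auto
  qed
  ultimately have \<tau>_bij: "bij_betw \<tau> S {..<n}" unfolding bij_betw_def by simp
  define b where "b = inv_into S \<tau>"
  have b: "bij_betw b {..<n} S" unfolding b_def by (rule bij_betw_inv_into[OF \<tau>_bij])
  have fin: "finite S" using bij_betw_finite[OF \<tau>_bij] by simp
  have "labelled_cube_group G S (\<lambda>g. b ` \<psi> g)"
  proof unfold_locales
    show "cube_labelling (\<lambda>g. b ` \<psi> g) ?X S" by (rule cube_labelling_image[OF \<psi> b])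
    show "b ` \<psi> s = {s}" if "s \<in> S" for s
      using \<tau>[OF that] bij_betw_inv_into_left[OF \<tau>_bij that] by (simp add: b_def)
  qed (use G inv fin \<psi>1 in auto)
  moreover have "card S = n" using bij_betw_same_card[OF \<tau>_bij] by simp
  ultimately show thesis by (rule that)
qed

section \<open>Faces at the identity and their opposite vertices\<close>

context labelled_cube_group
begin

text \<open>An explicit form of \<open>g\<^sub>T\<close>; the agreement with
  \<open>opposite_vertex\<close> is \<open>opposite_vertex_eq\<close>.\<close>

definition vertex :: "'a set \<Rightarrow> 'a" where
  "vertex = inv_into (carrier G) F"

lemma label_bij: "bij_betw F (carrier G) (Pow S)"
  using labelling unfolding cube_labelling_def cayley_graph_def by simp

lemma label_inj: "g \<in> carrier G \<Longrightarrow> h \<in> carrier G \<Longrightarrow> F g = F h \<longleftrightarrow> g = h"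
  using label_bij by (auto simp: bij_betw_def inj_on_def)

lemma label_subset: "g \<in> carrier G \<Longrightarrow> F g \<subseteq> S"
  using label_bij by (auto dest: bij_betwE)

lemma vertex_bij: "bij_betw vertex (Pow S) (carrier G)"
  unfolding vertex_def by (rule bij_betw_inv_into[OF label_bij])

lemma vertex_closed: "A \<subseteq> S \<Longrightarrow> vertex A \<in> carrier G"
  using vertex_bij by (auto dest: bij_betwE)

lemma label_vertex: "A \<subseteq> S \<Longrightarrow> F (vertex A) = A"
  unfolding vertex_def using bij_betw_inv_into_right[OF label_bij] by blast

lemma vertex_label: "g \<in> carrier G \<Longrightarrow> vertex (F g) = g"
  unfolding vertex_def by (rule bij_betw_inv_into_left[OF label_bij])

lemma set_adj_label:
  assumes "g \<in> carrier G" "h \<in> carrier G"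
  shows "set_adj (F g) (F h) \<longleftrightarrow> (\<exists>s\<in>S. h = g \<otimes> s)"
proof -
  have "set_adj (F g) (F h) \<longleftrightarrow> {g, h} \<in> snd (cayley_graph G S)"
    using labelling assms unfolding cube_labelling_def by (simp add: cayley_graph_def)
  also have "\<dots> \<longleftrightarrow> (\<exists>s\<in>S. h = g \<otimes> s)"
    by (rule cayley_graph_edge[OF group_axioms gens_closed involution assms])
  finally show ?thesis .
qed

lemma order_eq: "order G = 2 ^ card S"
  using bij_betw_same_card[OF label_bij] finite_gens by (simp add: order_def card_Pow)

text \<open>The label of \<open>\<one>\<close> is empty, so the face condition of
  \<open>subcube_is_face\<close>, read from \<open>\<one>\<close>, becomes
  \<open>F g \<subseteq> K\<close>.\<close>

lemma subcube_containing_one: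
  assumes "subcube (cayley_graph G S) C" "\<one> \<in> C"
  obtains K where "K \<subseteq> S" "C = {g \<in> carrier G. F g \<subseteq> K}"
proof -
  have C: "C \<subseteq> fst (cayley_graph G S)" "C \<subseteq> carrier G"
    using assms(1) by (auto simp: subcube_def cayley_graph_def)
  obtain k h where h: "graph_iso h (induced_subgraph (cayley_graph G S) C) (cube_graph k)"
    using assms(1) unfolding subcube_def isomorphic_graphs_def by blast
  obtain K where K: "K \<subseteq> S"
    "\<forall>u\<in>C. \<forall>w\<in>fst (cayley_graph G S). w \<in> C \<longleftrightarrow> sym_diff (F u) (F w) \<subseteq> K"
    by (rule subcube_is_face[OF labelling C(1) h]) (rule that)
  have "w \<in> C \<longleftrightarrow> F w \<subseteq> K" if "w \<in> carrier G" for w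
    using bspec[OF bspec[OF K(2) assms(2)], of w] that label_one by (simp add: cayley_graph_def)
  then show thesis using that[OF K(1)] C(2) by blast
qed

text \<open>It suffices to test the inclusion on the top vertex \<open>vertex K\<close>, whose label
  is all of \<open>K\<close>.\<close>

lemma face_inclusion:
  assumes "K \<subseteq> S" "{g \<in> carrier G. F g \<subseteq> K} \<subseteq> {g \<in> carrier G. F g \<subseteq> L}"
  shows "K \<subseteq> L"
proof -
  have "vertex K \<in> {g \<in> carrier G. F g \<subseteq> K}"
    using vertex_closed[OF assms(1)] label_vertex[OF assms(1)] by simp
  then have "F (vertex K) \<subseteq> L" using assms(2) by blast
  then show ?thesis using label_vertex[OF assms(1)] by simp
qed

lemma subcube_face:
  assumes "T \<subseteq> S"
  shows "subcube (cayley_graph G S) {g \<in> carrier G. F g \<subseteq> T}"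
proof -
  have "fst (cayley_graph G S) = carrier G" by (simp add: cayley_graph_def)
  then show ?thesis
    using face_is_subcube[OF labelling assms finite_subset[OF assms finite_gens]]
    unfolding subcube_def isomorphic_graphs_def by auto
qed

lemma gens_in_face:
  assumes "T \<subseteq> S" "T \<subseteq> {g \<in> carrier G. F g \<subseteq> K}"
  shows "T \<subseteq> K"
proof
  fix s assume "s \<in> T"
  then have "F s \<subseteq> K" "F s = {s}" using assms label_gen by auto
  then show "s \<in> K" by simp
qed

text \<open>A subcube through \<open>\<one>\<close> is the face of some \<open>K\<close>, and it
  contains the generators in \<open>T\<close> only if \<open>T \<subseteq> K\<close>. So the face of
  \<open>T\<close> is the least candidate, and the first definite description in
  \<open>opposite_vertex\<close> is well defined.\<close>

lemma minimal_subcube_iff: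
  assumes T: "T \<subseteq> S"
  shows "minimal_subcube (cayley_graph G S) (insert \<one> T) C \<longleftrightarrow> C = {g \<in> carrier G. F g \<subseteq> T}"
    (is "?min C \<longleftrightarrow> C = ?C")
proof -
  have sub: "insert \<one> T \<subseteq> ?C" using T gens_closed label_one label_gen by auto
  show ?thesis
  proof
    assume C: "?min C"
    then have "subcube (cayley_graph G S) C" "\<one> \<in> C" "T \<subseteq> C"
      unfolding minimal_subcube_def by auto
    then obtain K where K: "C = {g \<in> carrier G. F g \<subseteq> K}"
      by (elim subcube_containing_one)
    then have "T \<subseteq> K" using gens_in_face T \<open>T \<subseteq> C\<close> by simp
    then have "?C \<subseteq> C" using K by auto
    then show "C = ?C" using C sub subcube_face[OF T] unfolding minimal_subcube_def by blast
  next
    assume C: "C = ?C"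
    have "D = ?C" if D: "subcube (cayley_graph G S) D" "insert \<one> T \<subseteq> D" "D \<subseteq> ?C" for D
    proof -
      have "\<one> \<in> D" using D(2) by simp
      then obtain K where K: "D = {g \<in> carrier G. F g \<subseteq> K}"
        by (rule subcube_containing_one[OF D(1)])
      then have "T \<subseteq> K" using gens_in_face T D(2) by simp
      then have "?C \<subseteq> D" using K by auto
      then show ?thesis using D(3) by simp
    qed
    then show "?min C"
      unfolding minimal_subcube_def C using sub subcube_face[OF T] by simp
  qed
qed

text \<open>Oppositeness refers to some isomorphism with a cube. By \<open>subcube_is_face\<close>,
  every such isomorphism yields a direction set \<open>K\<close> for the same face, hence
  \<open>K = T\<close>, and the vertex opposite to \<open>\<one>\<close> is always the one with
  label \<open>T\<close>.\<close>

lemma opposite_in_face_iff: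
  assumes T: "T \<subseteq> S"
  shows "opposite_in (cayley_graph G S) {g \<in> carrier G. F g \<subseteq> T} \<one> g \<longleftrightarrow> g = vertex T"
    (is "opposite_in ?X ?C \<one> g \<longleftrightarrow> _")
proof -
  have C: "?C \<subseteq> fst ?X" and one: "\<one> \<in> ?C" using label_one by (auto simp: cayley_graph_def)
  have vT: "vertex T \<in> ?C" using vertex_closed[OF T] label_vertex[OF T] by simp
  have opp: "(\<forall>i<k. h \<one> i \<noteq> h w i) \<longleftrightarrow> w = vertex T"
    if h: "graph_iso h (induced_subgraph ?X ?C) (cube_graph k)" and w: "w \<in> ?C" for h k w
  proof -
    obtain K where K: "K \<subseteq> S"
      "\<forall>u\<in>?C. \<forall>w\<in>fst ?X. w \<in> ?C \<longleftrightarrow> sym_diff (F u) (F w) \<subseteq> K"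
      "\<forall>u\<in>?C. \<forall>w\<in>?C. (\<forall>i<k. h u i \<noteq> h w i) \<longleftrightarrow> sym_diff (F u) (F w) = K"
      by (rule subcube_is_face[OF labelling C h]) (rule that)
    have "F w \<subseteq> T \<longleftrightarrow> F w \<subseteq> K" if "w \<in> carrier G" for w
      using bspec[OF bspec[OF K(2) one], of w] that label_one by (simp add: cayley_graph_def)
    then have eq: "?C = {g \<in> carrier G. F g \<subseteq> K}" by blast
    have "T \<subseteq> K" by (rule face_inclusion[OF T equalityD1[OF eq]])
    moreover have "K \<subseteq> T" by (rule face_inclusion[OF K(1) equalityD2[OF eq]])
    ultimately have "K = T" by simp
    then have "(\<forall>i<k. h \<one> i \<noteq> h w i) \<longleftrightarrow> F w = T"
      using bspec[OF bspec[OF K(3) one] w] label_one by simp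
    then show ?thesis
      using label_vertex[OF T] vertex_label w by auto
  qed
  obtain k h where "graph_iso h (induced_subgraph ?X ?C) (cube_graph k)"
    using subcube_face[OF T] unfolding subcube_def isomorphic_graphs_def by blast
  then show ?thesis
    unfolding opposite_in_def using opp one vT by blast
qed

lemma opposite_vertex_eq:
  assumes "T \<subseteq> S"
  shows "opposite_vertex G S T = vertex T"
  unfolding opposite_vertex_def Let_def minimal_subcube_iff[OF assms]
  by (rule the_equality) (simp_all add: opposite_in_face_iff[OF assms])

text \<open>Since \<open>vertex\<close> and \<open>F\<close> are mutually inverse,
  \<open>F g\<close> is the only \<open>T\<close> with \<open>g\<^sub>T = g\<close>.\<close>

lemma vertex_vector_eq:
  assumes "g \<in> carrier G"
  shows "vertex_vector G S \<sigma> g = sign_vector \<sigma> (F g)"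
proof -
  have "(THE T. T \<subseteq> S \<and> opposite_vertex G S T = g) = F g"
    using assms label_subset vertex_label label_vertex opposite_vertex_eq
    by (intro the_equality) auto
  then show ?thesis unfolding vertex_vector_def by simp
qed

section \<open>The permutation part of left multiplication\<close>

text \<open>Edges come from right multiplication by generators, which commutes with left
  multiplication by \<open>g\<close>. Hence \<open>g\<close> induces an embedding of the cube into
  itself, and \<open>cube_embedding\<close> applies.\<close>

lemma ex_perm:
  assumes g: "g \<in> carrier G"
  shows "\<exists>q. bij_betw q S S \<and> (\<forall>A\<subseteq>S. F (g \<otimes> vertex A) = sym_diff (F g) (q ` A))"
proof -
  define \<phi> where "\<phi> = (\<lambda>A. F (g \<otimes> vertex A))"
  have closed: "g \<otimes> vertex A \<in> carrier G" if "A \<subseteq> S" for A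
    using g vertex_closed[OF that] by simp
  have inj: "inj_on \<phi> (Pow S)"
  proof (rule inj_onI)
    fix A B assume AB: "A \<in> Pow S" "B \<in> Pow S" "\<phi> A = \<phi> B"
    then have "g \<otimes> vertex A = g \<otimes> vertex B" using label_inj closed unfolding \<phi>_def by auto
    then have "vertex A = vertex B" using g AB vertex_closed by simp
    then show "A = B" using label_vertex AB by (metis PowD)
  qed
  have adj: "set_adj (\<phi> A) (\<phi> B)" if AB: "A \<subseteq> S" "B \<subseteq> S" "set_adj A B" for A B
  proof -
    have "set_adj (F (vertex A)) (F (vertex B))" using AB by (simp add: label_vertex)
    then obtain s where s: "s \<in> S" "vertex B = vertex A \<otimes> s"
      using set_adj_label[OF vertex_closed[OF AB(1)] vertex_closed[OF AB(2)]] by auto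
    moreover have "s \<in> carrier G" using s(1) gens_closed by blast
    ultimately have "g \<otimes> vertex B = (g \<otimes> vertex A) \<otimes> s"
      using g vertex_closed[OF AB(1)] by (simp add: m_assoc)
    then show ?thesis
      unfolding \<phi>_def using set_adj_label[OF closed[OF AB(1)] closed[OF AB(2)]] s(1) by auto
  qed
  obtain q where q: "inj_on q S" "\<forall>A\<subseteq>S. \<phi> A = sym_diff (\<phi> {}) (q ` A)"
    by (rule cube_embedding[OF finite_gens inj]) (erule (2) adj, rule that)
  have "vertex {} = \<one>" using vertex_label[OF one_closed] label_one by simp
  then have \<phi>0: "\<phi> {} = F g" using g by (simp add: \<phi>_def)
  \<comment> \<open>The map \<open>q\<close> given by \<open>cube_embedding\<close> comes without a
    range; its image is the difference of two labels, hence lies in \<open>S\<close>.\<close>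
  have "q ` S = sym_diff (F g) (\<phi> S)" using spec[OF q(2), of S] \<phi>0 by auto
  then have "q ` S \<subseteq> S"
    using label_subset[OF g] label_subset[OF closed[of S]] by (auto simp: \<phi>_def)
  then have "bij_betw q S S"
    using q(1) endo_inj_surj[OF finite_gens] unfolding bij_betw_def by blast
  then show ?thesis using q(2) unfolding \<phi>0 unfolding \<phi>_def by blast
qed

text \<open>The permutation part of the signed permutation given by left multiplication.\<close>

definition perm :: "'a \<Rightarrow> 'a \<Rightarrow> 'a" where
  "perm g = (SOME q. bij_betw q S S \<and> (\<forall>A\<subseteq>S. F (g \<otimes> vertex A) = sym_diff (F g) (q ` A)))"

lemma
  assumes "g \<in> carrier G"
  shows perm_bij: "bij_betw (perm g) S S"
    and label_mult_vertex: "A \<subseteq> S \<Longrightarrow> F (g \<otimes> vertex A) = sym_diff (F g) (perm g ` A)"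
proof -
  have "bij_betw (perm g) S S \<and> (\<forall>A\<subseteq>S. F (g \<otimes> vertex A) = sym_diff (F g) (perm g ` A))"
    unfolding perm_def by (rule someI_ex[OF ex_perm[OF assms]])
  then show "bij_betw (perm g) S S"
    and "A \<subseteq> S \<Longrightarrow> F (g \<otimes> vertex A) = sym_diff (F g) (perm g ` A)" by simp_all
qed

lemma label_mult:
  assumes "g \<in> carrier G" "h \<in> carrier G"
  shows "F (g \<otimes> h) = sym_diff (F g) (perm g ` F h)"
  using label_mult_vertex[OF assms(1) label_subset[OF assms(2)]] vertex_label[OF assms(2)] by simp

lemma perm_closed: "g \<in> carrier G \<Longrightarrow> s \<in> S \<Longrightarrow> perm g s \<in> S"
  using perm_bij by (auto dest: bij_betwE)

lemma perm_image_closed: "g \<in> carrier G \<Longrightarrow> A \<subseteq> S \<Longrightarrow> perm g ` A \<subseteq> S"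
  using perm_closed by blast

text \<open>Compute the label of \<open>g \<otimes> h \<otimes> vertex A\<close> in two ways and
  cancel \<open>F (g \<otimes> h)\<close>. The law concerns images of subsets of \<open>S\<close>,
  since the choice in \<open>perm\<close> leaves values outside \<open>S\<close>
  undetermined.\<close>

lemma perm_mult:
  assumes g: "g \<in> carrier G" and h: "h \<in> carrier G" and A: "A \<subseteq> S"
  shows "perm (g \<otimes> h) ` A = perm g ` perm h ` A"
proof -
  note v = vertex_closed[OF A]
  have "sym_diff (F (g \<otimes> h)) (perm (g \<otimes> h) ` A) = F (g \<otimes> h \<otimes> vertex A)"
    using label_mult_vertex[OF _ A] g h by simp
  also have "\<dots> = F (g \<otimes> (h \<otimes> vertex A))" using g h v by (simp add: m_assoc)
  also have "\<dots> = sym_diff (F g) (perm g ` sym_diff (F h) (perm h ` A))"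
    using label_mult[OF g] label_mult_vertex[OF h A] h v by simp
  also have "\<dots> = sym_diff (F g) (sym_diff (perm g ` F h) (perm g ` perm h ` A))"
    using sym_diff_image[of "perm g" S "F h" "perm h ` A"] perm_bij[OF g] label_subset[OF h]
      perm_image_closed[OF h A] by (simp add: bij_betw_def)
  also have "\<dots> = sym_diff (F (g \<otimes> h)) (perm g ` perm h ` A)"
    unfolding label_mult[OF g h] by blast
  finally show ?thesis by blast
qed

text \<open>The product \<open>s \<otimes> s = \<one>\<close> has empty label, but also the label
  \<open>sym_diff {s} {perm s s}\<close>.\<close>

lemma perm_gen_fixes:
  assumes s: "s \<in> S"
  shows "perm s s = s"
proof -
  have "s \<in> carrier G" using s gens_closed by blast
  then have "sym_diff {s} {perm s s} = {}"
    using label_mult[of s s] involution[OF s] label_gen[OF s] label_one by simp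
  then show ?thesis by blast
qed

text \<open>Induction on the distance of \<open>g\<close> from \<open>\<one>\<close> in the cube:
  deleting one element from the label of \<open>g\<close> gives a neighbour \<open>h\<close> nearer
  to \<open>\<one>\<close>, and \<open>g\<close> is \<open>h\<close> times a generator.\<close>

lemma invariant_if_gens:
  assumes A: "A \<subseteq> S" and gens: "\<And>s. s \<in> S \<Longrightarrow> perm s ` A = A" and g: "g \<in> carrier G"
  shows "perm g ` A = A"
  using g
proof (induction "card (F g)" arbitrary: g)
  case 0
  have "finite (F g)" using label_subset[OF 0(2)] finite_gens finite_subset by blast
  then have "F g = F \<one>" using 0 label_one by simp
  then have g: "g = \<one>" using label_inj 0(2) by simp
  have "vertex A = \<one> \<otimes> vertex A" using vertex_closed[OF A] by simp
  then have "A = F (\<one> \<otimes> vertex A)" using label_vertex[OF A] by simp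
  then show ?case using label_mult_vertex[OF one_closed A] label_one g by simp
next
  case (Suc k)
  then obtain s where s: "s \<in> F g" by fastforce
  define h where "h = vertex (F g - {s})"
  have sub: "F g - {s} \<subseteq> S" using label_subset Suc.prems by blast
  have h: "h \<in> carrier G" "F h = F g - {s}"
    unfolding h_def using vertex_closed[OF sub] label_vertex[OF sub] by auto
  have "sym_diff (F h) (F g) = {s}" using h(2) s by auto
  \<comment> \<open>The edge from \<open>h\<close> to \<open>g\<close> belongs to a generator
    \<open>t\<close> with \<open>perm h t = s\<close>, which may differ from
    \<open>s\<close>.\<close>
  then obtain t where t: "t \<in> S" "g = h \<otimes> t"
    using set_adj_label[OF h(1) Suc.prems] unfolding set_adj_def by auto
  have "card (F h) = k" using Suc.hyps(2) s h(2) by simp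
  then have "perm h ` A = A" using Suc.hyps(1) h(1) by simp
  moreover have "t \<in> carrier G" using t(1) gens_closed by blast
  ultimately show ?case using perm_mult[OF h(1) _ A] gens[OF t(1)] t(2) by simp
qed

section \<open>An invariant set of generators\<close>

text \<open>Each \<open>perm g\<close> permutes \<open>S\<close>, so on subsets it fixes
  \<open>{}\<close> and \<open>S\<close> and permutes the others; \<open>perm_mult\<close> gives the
  homomorphism law. The restriction is there because elements of \<open>BijGroup\<close> are
  extensional.\<close>

lemma perm_action:
  "group_action G (Pow S - {{}, S}) (\<lambda>g. \<lambda>A\<in>Pow S - {{}, S}. perm g ` A)"
proof -
  let ?E = "Pow S - {{}, S}"
  have bij: "bij_betw ((`) (perm g)) ?E ?E" if g: "g \<in> carrier G" for g
  proof -
    have "bij_betw ((`) (perm g)) (Pow S) (Pow S)" by (rule bij_betw_Pow[OF perm_bij[OF g]])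
    moreover have "bij_betw ((`) (perm g)) {{}, S} {{}, S}"
      using perm_bij[OF g] by (auto simp: bij_betw_def inj_on_def)
    ultimately show ?thesis
      by (auto intro!: bij_betw_DiffI)
  qed
  have Bij: "(\<lambda>A\<in>?E. perm g ` A) \<in> Bij ?E" if "g \<in> carrier G" for g
    using bij[OF that] bij_betw_cong[of ?E "\<lambda>A\<in>?E. perm g ` A" "(`) (perm g)" ?E]
    by (simp add: Bij_def)
  have "(\<lambda>A\<in>?E. perm (g \<otimes> h) ` A) = compose ?E (\<lambda>A\<in>?E. perm g ` A) (\<lambda>A\<in>?E. perm h ` A)"
    if g: "g \<in> carrier G" and h: "h \<in> carrier G" for g h
  proof
    fix A
    show "(\<lambda>A\<in>?E. perm (g \<otimes> h) ` A) A
        = compose ?E (\<lambda>A\<in>?E. perm g ` A) (\<lambda>A\<in>?E. perm h ` A) A"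
    proof (cases "A \<in> ?E")
      case True
      have "perm h ` A \<in> ?E" by (rule bspec[OF bij_betwE[OF bij[OF h]] True])
      then show ?thesis using True perm_mult[OF g h, of A] by (simp add: compose_def)
    next
      case False
      then show ?thesis unfolding compose_def restrict_def by (simp only: if_False)
    qed
  qed
  then have "(\<lambda>g. \<lambda>A\<in>?E. perm g ` A) \<in> hom G (BijGroup ?E)"
    using Bij by (intro homI) (simp_all add: BijGroup_def)
  then show ?thesis
    unfolding group_action_def group_hom_def group_hom_axioms_def
    using group_axioms group_BijGroup by blast
qed

lemma ex_invariant_subset:
  assumes "card S \<ge> 2"
  obtains A where "A \<subseteq> S" "A \<noteq> {}" "A \<noteq> S" "\<And>g. g \<in> carrier G \<Longrightarrow> perm g ` A = A"
proof -
  let ?E = "Pow S - {{}, S}"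
  define act where "act = (\<lambda>g. \<lambda>A\<in>?E. perm g ` A)"
  interpret action: group_action G ?E act unfolding act_def by (rule perm_action)
  have "S \<noteq> {}" using assms by auto
  then have "card ?E = 2 ^ card S - 2"
    using finite_gens by (simp add: card_Diff_subset card_Pow)
  moreover have "(4::nat) dvd 2 ^ card S" using le_imp_power_dvd[OF assms, of "2::nat"] by simp
  moreover have "(2::nat) ^ card S \<ge> 4" using power_increasing[OF assms, of "2::nat"] by simp
  \<comment> \<open>As 4 divides \<open>2 ^ card S\<close>, the number of sets is 2 modulo
    4.\<close>
  ultimately have "\<not> 4 dvd card ?E" by presburger
  then obtain A i where A: "A \<in> ?E" and "i < 2" "card (orbit G act A) = 2 ^ i"
    using action.ex_small_orbit[of 2 "card S" 2] order_eq finite_gens by auto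
  define \<O> where "\<O> = orbit G act A"
  have card_orbit: "card \<O> = 1 \<or> card \<O> = 2"
    using \<open>i < 2\<close> \<open>card (orbit G act A) = 2 ^ i\<close> by (auto simp: \<O>_def less_2_cases_iff)
  have orbit: "\<O> = {perm g ` A | g. g \<in> carrier G}"
    unfolding \<O>_def orbit_def act_def using A by simp
  have "A \<in> \<O>" unfolding \<O>_def by (rule action.orbit_refl[OF A])
  have sub: "\<Union>\<O> \<subseteq> S" using A perm_image_closed orbit by blast
  have orbit_inv: "(\<lambda>B. perm g ` B) ` \<O> = \<O>" if g: "g \<in> carrier G" for g
  proof (intro equalityI subsetI)
    fix B assume "B \<in> (\<lambda>B. perm g ` B) ` \<O>"
    then obtain h where h: "h \<in> carrier G" "B = perm g ` perm h ` A" unfolding orbit by blast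
    then have "B = perm (g \<otimes> h) ` A" using perm_mult[OF g] A by simp
    then show "B \<in> \<O>" unfolding orbit using g h(1) by blast
  next
    fix B assume "B \<in> \<O>"
    then obtain h where h: "h \<in> carrier G" "B = perm h ` A" unfolding orbit by blast
    have "h = g \<otimes> (inv g \<otimes> h)" using g h(1) by (simp add: m_assoc[symmetric])
    then have "B = perm g ` perm (inv g \<otimes> h) ` A"
      using perm_mult[OF g, of "inv g \<otimes> h" A] g h A by auto
    then show "B \<in> (\<lambda>B. perm g ` B) ` \<O>" unfolding orbit using g h(1) by blast
  qed
  have Inter_inv: "perm g ` \<Inter>\<O> = \<Inter>\<O>" and Union_inv: "perm g ` \<Union>\<O> = \<Union>\<O>"
    if g: "g \<in> carrier G" for g
  proof -
    \<comment> \<open>Taking images commutes with the intersection because \<open>perm g\<close> is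
      injective on \<open>S\<close>, which contains every member of the orbit.\<close>
    have "perm g ` \<Inter>\<O> = \<Inter>((\<lambda>B. perm g ` B) ` \<O>)"
      using image_INT[of "perm g" S \<O> id A] perm_bij[OF g] sub \<open>A \<in> \<O>\<close>
      by (auto simp: bij_betw_def)
    then show "perm g ` \<Inter>\<O> = \<Inter>\<O>" unfolding orbit_inv[OF g] .
    show "perm g ` \<Union>\<O> = \<Union>\<O>" unfolding image_Union orbit_inv[OF g] ..
  qed
  consider "\<Inter>\<O> \<noteq> {}" | "\<Union>\<O> \<noteq> S" | "\<Inter>\<O> = {}" "\<Union>\<O> = S" by blast
  then show thesis
  proof cases
    case 1
    have "\<Inter>\<O> \<subseteq> A" using \<open>A \<in> \<O>\<close> by blast
    then show thesis using that[of "\<Inter>\<O>"] Inter_inv 1 A by blast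
  next
    case 2
    have "A \<subseteq> \<Union>\<O>" using \<open>A \<in> \<O>\<close> by blast
    then show thesis using that[of "\<Union>\<O>"] Union_inv 2 A sub by blast
  next
    case 3
    \<comment> \<open>A one-element orbit would have the nonempty intersection \<open>A\<close>. So
      there are two members, and they are complementary in \<open>S\<close>.\<close>
    have "\<O> \<noteq> {A}" using 3 A by auto
    then have "card \<O> \<noteq> 1" using \<open>A \<in> \<O>\<close> by (metis card_1_singletonE singletonD)
    then have "card \<O> = 2" using card_orbit by simp
    then obtain B1 B2 where "\<O> = {B1, B2}" by (meson card_2_iff)
    then obtain B where B: "\<O> = {A, B}"
      using \<open>A \<in> \<O>\<close> by (metis insertE insert_commute singletonD)
    then have AB: "A \<inter> B = {}" "A \<union> B = S" using 3 by auto
    have gens: "perm s ` A = A" if s: "s \<in> S" for s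
    proof -
      have sG: "s \<in> carrier G" using s gens_closed by blast
      \<comment> \<open>\<open>perm s\<close> is injective on \<open>S\<close> and fixes
        \<open>s\<close>, so it cannot move \<open>s\<close> into or out of the set; this excludes
        the complement \<open>B\<close> as image.\<close>
      have "s \<in> perm s ` A \<longleftrightarrow> s \<in> A"
        using inj_on_image_mem_iff[of "perm s" S s A] perm_bij[OF sG] perm_gen_fixes[OF s] s A
        by (simp add: bij_betw_def)
      moreover have "s \<in> A \<longleftrightarrow> s \<notin> B" using AB s by blast
      ultimately have "perm s ` A \<noteq> B" by metis
      moreover have "perm s ` A \<in> \<O>" unfolding orbit using sG by blast
      ultimately show ?thesis using B by simp
    qed
    have sub: "A \<subseteq> S" "A \<noteq> {}" "A \<noteq> S" using A by auto
    show thesis by (rule that[OF sub invariant_if_gens[OF sub(1) gens]])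
  qed
qed

end

section \<open>The geometric representation by signed permutations\<close>

lemma sign_vector_nth: "sign_vector \<sigma> T $ i = (if \<sigma> i \<in> T then -1 else 1)"
  unfolding sign_vector_def by (simp add: sum_component axis_def if_distrib cong: if_cong)

text \<open>Sign vectors span: a basis vector is half the difference of the sign vectors of
  \<open>{}\<close> and of a singleton. This gives the uniqueness behind the definite description in
  \<open>geometric_rep\<close>.\<close>

lemma linear_eq_on_sign_vectors:
  fixes f g :: "real ^ 's::finite \<Rightarrow> 'b::real_vector"
  assumes "linear f" "linear g" and "inj \<sigma>"
    and eq: "\<And>T. T \<subseteq> range \<sigma> \<Longrightarrow> f (sign_vector \<sigma> T) = g (sign_vector \<sigma> T)"
  shows "f = g"
proof (rule linear_eq_stdbasis[OF assms(1,2)])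
  fix b :: "real ^ 's"
  assume "b \<in> Basis"
  then obtain i where b: "b = axis i 1" by (auto simp: Basis_vec_def)
  have "b = (1 / 2) *\<^sub>R (sign_vector \<sigma> {} - sign_vector \<sigma> {\<sigma> i})"
    using injD[OF \<open>inj \<sigma>\<close>] unfolding b by (auto simp: vec_eq_iff sign_vector_nth axis_def)
  then show "f b = g b"
    using eq[of "{}"] eq[of "{\<sigma> i}"] by (simp add: linear_scale linear_diff assms(1,2))
qed

text \<open>Coordinates are pulled back along \<open>\<pi>\<close>: for bijective
  \<open>\<pi>\<close>, the basis vector of \<open>\<pi> i\<close> goes to plus or minus the basis
  vector of \<open>i\<close>, with minus for \<open>i \<in> N\<close>.\<close>

definition signed_permutation :: "'s set \<Rightarrow> ('s \<Rightarrow> 's) \<Rightarrow> real ^ 's::finite \<Rightarrow> real ^ 's" where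
  "signed_permutation N \<pi> v = (\<chi> i. (if i \<in> N then - 1 else 1) * v $ \<pi> i)"

lemma orthogonal_signed_permutation:
  assumes "bij \<pi>"
  shows "orthogonal_transformation (signed_permutation N \<pi>)"
proof -
  have "signed_permutation N \<pi> v \<bullet> signed_permutation N \<pi> w = v \<bullet> w" for v w
  proof -
    have "signed_permutation N \<pi> v \<bullet> signed_permutation N \<pi> w
        = (\<Sum>i\<in>UNIV. v $ \<pi> i * w $ \<pi> i)"
      unfolding inner_vec_def signed_permutation_def by (intro sum.cong) auto
    also have "\<dots> = v \<bullet> w"
      unfolding inner_vec_def using sum.reindex_bij_betw[OF assms, of "\<lambda>i. v $ i * w $ i"] by simp
    finally show ?thesis .
  qed
  moreover have "linear (signed_permutation N \<pi>)"
    by (rule linearI) (auto simp: signed_permutation_def vec_eq_iff algebra_simps)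
  ultimately show ?thesis unfolding orthogonal_transformation_def by simp
qed

context labelled_cube_group
begin

text \<open>On labels, \<open>g\<close> applies \<open>perm g\<close> and then toggles
  \<open>F g\<close>; on sign vectors this permutes coordinates and flips the signs in
  \<open>F g\<close>. That signed permutation is orthogonal and agrees with \<open>g\<close> on all
  vertices, so it is the representing map.\<close>

lemma geometric_rep_nth:
  fixes \<sigma> :: "'s::finite \<Rightarrow> 'a"
  assumes \<sigma>: "bij_betw \<sigma> UNIV S" and g: "g \<in> carrier G"
  obtains \<pi> where "\<And>i. perm g (\<sigma> (\<pi> i)) = \<sigma> i"
    "\<And>v i. geometric_rep G S \<sigma> g v $ i = (if \<sigma> i \<in> F g then - 1 else 1) * v $ \<pi> i"
proof -
  have \<sigma>_inj: "inj \<sigma>" and \<sigma>_range: "range \<sigma> = S" using \<sigma> by (auto simp: bij_betw_def)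
  \<comment> \<open>The inverse of \<open>perm g\<close>, carried to the index type by
    \<open>\<sigma>\<close>; inverse because \<open>signed_permutation\<close> pulls coordinates
    back.\<close>
  define \<pi> where "\<pi> = inv_into UNIV \<sigma> \<circ> (inv_into S (perm g) \<circ> \<sigma>)"
  have \<pi>_bij: "bij \<pi>"
    unfolding \<pi>_def using \<sigma> perm_bij[OF g] by (meson bij_betw_inv_into bij_betw_trans)
  have "\<sigma> (\<pi> i) = inv_into S (perm g) (\<sigma> i)" for i
    using bij_betw_inv_into_right[OF \<sigma>] bij_betwE[OF bij_betw_inv_into[OF perm_bij[OF g]]]
      \<sigma>_range by (auto simp: \<pi>_def)
  then have \<pi>: "perm g (\<sigma> (\<pi> i)) = \<sigma> i" for i
    using bij_betw_inv_into_right[OF perm_bij[OF g]] \<sigma>_range by auto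
  define f where "f = signed_permutation {i. \<sigma> i \<in> F g} \<pi>"
  have f: "f (vertex_vector G S \<sigma> h) = vertex_vector G S \<sigma> (g \<otimes> h)" if h: "h \<in> carrier G" for h
  proof -
    have "\<sigma> i \<in> perm g ` F h \<longleftrightarrow> \<sigma> (\<pi> i) \<in> F h" for i
    proof
      assume "\<sigma> i \<in> perm g ` F h"
      then obtain s where s: "s \<in> F h" "perm g s = perm g (\<sigma> (\<pi> i))" using \<pi> by auto
      have "s \<in> S" "\<sigma> (\<pi> i) \<in> S" using s(1) label_subset[OF h] \<sigma>_range by auto
      then have "s = \<sigma> (\<pi> i)"
        using s(2) perm_bij[OF g] by (auto simp: bij_betw_def inj_on_def)
      then show "\<sigma> (\<pi> i) \<in> F h" using s(1) by simp
    qed (metis \<pi> imageI)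
    then show ?thesis
      using g h by (auto simp: f_def signed_permutation_def vec_eq_iff vertex_vector_eq
          sign_vector_nth label_mult)
  qed
  have orth: "orthogonal_transformation f"
    unfolding f_def by (rule orthogonal_signed_permutation[OF \<pi>_bij])
  have "geometric_rep G S \<sigma> g = f"
    unfolding geometric_rep_def
  proof (rule the_equality)
    fix f'
    assume f': "orthogonal_transformation f' \<and>
      (\<forall>h\<in>carrier G. f' (vertex_vector G S \<sigma> h) = vertex_vector G S \<sigma> (g \<otimes> h))"
    show "f' = f"
    proof (rule linear_eq_on_sign_vectors[OF _ _ \<sigma>_inj])
      fix T assume "T \<subseteq> range \<sigma>"
      then have T: "T \<subseteq> S" using \<sigma>_range by simp
      then show "f' (sign_vector \<sigma> T) = f (sign_vector \<sigma> T)"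
        using f f' vertex_closed[OF T] vertex_vector_eq[OF vertex_closed[OF T]]
          label_vertex[OF T] by metis
    qed (use f' orth in \<open>auto simp: orthogonal_transformation_def\<close>)
  qed (use f orth in auto)
  then show thesis
    using that[OF \<pi>] by (simp add: f_def signed_permutation_def)
qed

section \<open>The invariant coordinate subspace\<close>

lemma reducible_geometric_rep:
  fixes \<sigma> :: "'s::finite \<Rightarrow> 'a"
  assumes \<sigma>: "bij_betw \<sigma> UNIV S" and "card S \<ge> 2"
  shows "reducible_rep G (geometric_rep G S \<sigma>)"
proof -
  obtain A where A: "A \<subseteq> S" "A \<noteq> {}" "A \<noteq> S"
    and inv: "\<And>g. g \<in> carrier G \<Longrightarrow> perm g ` A = A"
    using ex_invariant_subset[OF assms(2)] by blast
  have range: "range \<sigma> = S" using \<sigma> by (simp add: bij_betw_def)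
  \<comment> \<open>The index \<open>i\<close> puts a basis vector into \<open>W\<close>, and
    \<open>j\<close> keeps one out, so \<open>W\<close> is nonzero and proper.\<close>
  obtain i j where ij: "\<sigma> i \<in> A" "\<sigma> j \<notin> A" using A range by blast
  define W where "W = {v :: real ^ 's. \<forall>i. \<sigma> i \<notin> A \<longrightarrow> v $ i = 0}"
  have "subspace W" by (rule subspaceI) (auto simp: W_def)
  moreover have "axis i 1 \<in> W" using ij by (auto simp: W_def axis_def)
  then have "W \<noteq> {0}" by (auto simp: axis_eq_0_iff)
  moreover have "axis j 1 \<notin> W" using ij by (auto simp: W_def axis_def)
  then have "W \<noteq> UNIV" by auto
  moreover have "geometric_rep G S \<sigma> g ` W \<subseteq> W" if g: "g \<in> carrier G" for g
  proof -
    obtain \<pi> where \<pi>: "\<And>i. perm g (\<sigma> (\<pi> i)) = \<sigma> i"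
      and rep: "\<And>v i. geometric_rep G S \<sigma> g v $ i
        = (if \<sigma> i \<in> F g then - 1 else 1) * v $ \<pi> i"
      using geometric_rep_nth[OF \<sigma> g] by blast
    \<comment> \<open>As \<open>perm g\<close> maps \<open>A\<close> into \<open>A\<close>, a
      coordinate outside \<open>A\<close> takes its new value from a coordinate outside
      \<open>A\<close>, where vectors of \<open>W\<close> vanish.\<close>
    have "\<sigma> (\<pi> i) \<notin> A" if "\<sigma> i \<notin> A" for i using that \<pi>[of i] inv[OF g] by (metis imageI)
    then show ?thesis by (auto simp: W_def rep)
  qed
  ultimately show ?thesis unfolding reducible_rep_def by blast
qed

end

theorem mainTheorem2:
  fixes G :: "('a, 'b) monoid_scheme"
    and S :: "'a set"
    and \<sigma> :: "'s::finite \<Rightarrow> 'a"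
    and n :: nat
  assumes "cube_group G S n" and "n \<ge> 2" and "bij_betw \<sigma> UNIV S"
  shows "reducible_rep G (geometric_rep G S \<sigma>)"
proof -
  obtain F where "labelled_cube_group G S F" "card S = n"
    using cube_group_labelling[OF assms(1)] by blast
  then show ?thesis
    using labelled_cube_group.reducible_geometric_rep assms(2,3) by blast
qed

end
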